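(* The following two statements hold. (1) Let $n$ be a positive integer. Then $$\mathbb{P}_{n}^{T}(x)\sim\frac{\log x}{\log\log x}\qquad\text{as } x\to\infty.$$ (2) We have $$\mathrm{Diag}\mathbb{P}(x)\sim \frac{\log x}{\log\log x}\qquad\text{as } x\to\infty.$$
   Context: $p_n$ denotes the $n$th prime number ($p_1=2$, $p_2=3$, ...). For positive integers $n,k$, define $p_n^{(k)}$ recursively by $p_n^{(1)}:=p_n$ and $p_n^{(k)}:=p_{p_n^{(k-1)}}$ for $k\ge 2$. Let $\mathbb{N}$ be the set of positive integers, and define the sets $\mathrm{Diag}\mathbb{P}:=\{p_k^{(k)} : k\in\mathbb{N}\}$ and $\mathbb{P}_n^T:=\{p_n^{(k)} : k\in\mathbb{N}\}$ for each $n\in\mathbb{N}$. For a set $A\subseteq\mathbb{N}$, its counting function is $A(x):=\#(A\cap[1,x])$; thus $\mathrm{Diag}\mathbb{P}(x)$ and $\mathbb{P}_n^T(x)$ are the counting functions of the sets above. $\log$ is the natural logarithm, and $f\sim g$ means $\lim_{x\to\infty} f(x)/g(x)=1$. *)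

theory Defs
  imports
    Complex_Main
    "HOL-Library.Infinite_Set"
    "HOL-Library.Landau_Symbols"
    "HOL-Computational_Algebra.Primes"
begin

text \<open>The primes are indexed from 1, whereas \<^const>\<open>enumerate\<close> starts at 0.
  The value at 0 is junk.\<close>

definition nth_prime :: "nat \<Rightarrow> nat" where
  "nth_prime n = enumerate {p. prime p} (n - 1)"

lemma nth_prime_1: "nth_prime 1 = 2"
  by (auto simp: nth_prime_def enumerate_0 intro!: Least_equality dest: prime_ge_2_nat)

lemma nth_prime_prime: "prime (nth_prime n)"
  using enumerate_in_set[OF primes_infinite] by (simp add: nth_prime_def)

lemma nth_prime_less: "0 < m \<Longrightarrow> m < n \<Longrightarrow> nth_prime m < nth_prime n"
  using enumerate_mono[OF _ primes_infinite, of "m - 1" "n - 1"] by (simp add: nth_prime_def)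

lemma nth_prime_surj: "prime p \<Longrightarrow> \<exists>n>0. nth_prime n = p"
  using enumerate_Ex[OF primes_infinite, of p]
  by (auto simp: nth_prime_def intro: exI[of _ "Suc _"])

text \<open>\<open>iter_prime k n\<close> is $p_n^{(k)}$. The recursion starts one step earlier than usual,
  with $p_n^{(0)} = n$, which gives $p_n^{(1)} = p_n$.\<close>

primrec iter_prime :: "nat \<Rightarrow> nat \<Rightarrow> nat" where
  "iter_prime 0 n = n"
| "iter_prime (Suc k) n = nth_prime (iter_prime k n)"

lemma iter_prime_1: "iter_prime 1 n = nth_prime n"
  by simp

lemma iter_prime_rec: "k \<ge> 2 \<Longrightarrow> iter_prime k n = nth_prime (iter_prime (k - 1) n)"
  by (cases k) auto

definition diag_primes :: "nat set" where
  "diag_primes = {iter_prime k k |k. k \<ge> 1}"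

definition prime_orbit :: "nat \<Rightarrow> nat set" where
  "prime_orbit n = {iter_prime k n |k. k \<ge> 1}"

definition counting :: "nat set \<Rightarrow> real \<Rightarrow> nat" where
  "counting A x = card {a \<in> A. 1 \<le> real a \<and> real a \<le> x}"

end

theory Submission
  imports Defs "HOL-Real_Asymp.Real_Asymp"
begin

text \<open>
  Write $b_k = \log p_n^{(k)}$. Chebyshev's bounds $p_m \asymp m \log m$ give
  $b_{k+1} = b_k + \log b_k + O(1)$. Hence $b_k \ge k \log k - O(k)$, and, as $b$ increases,
  $b_k \le \log n + k (\log b_k + O(1))$; the latter is uniform in $n$, so it also applies to
  $n = k$. Both bounds together force $b_k \sim k \log k$, for fixed $n$ as well as for $n = k$,
  and the counting function is the asymptotic inverse $y / \log y$ of $k \log k$ at $y = \log x$.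

  Chebyshev's bounds themselves come out for $p_m$ directly: $m! \le p_1 \cdots p_m \le 4^{p_m}$,
  and, with $N = p_m$, $2^{N-1} \le N \binom{N-1}{\lfloor (N-1)/2 \rfloor} \le N^m$, because
  $N \binom{N-1}{k}$ divides the least common multiple of $1, \dots, N$.
\<close>

section \<open>Asymptotics and counting functions\<close>

text \<open>The upper bound is implicit in \<open>y\<close>. Solved for \<open>k\<close>, it gives a
  lower bound for \<open>k\<close> in terms of \<open>y k\<close>, so that \<open>k * ln k\<close>
  is squeezed between two functions of order \<open>y\<close>. The term \<open>ln k\<close> leaves
  room for a starting index that grows linearly with \<open>k\<close>.\<close>

lemma asymp_equiv_n_ln_n:
  fixes y :: "nat \<Rightarrow> real"
  assumes lower: "\<forall>\<^sub>F k in sequentially. real k * ln (real k) - A * real k \<le> y k"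
    and upper: "\<forall>\<^sub>F k in sequentially. y k \<le> B + ln (real k) + real k * (ln (y k) + C)"
  shows "y \<sim>[sequentially] (\<lambda>k. real k * ln (real k))"
proof -
  have k_le: "\<forall>\<^sub>F k in sequentially. real k \<le> y k"
  proof -
    have "\<forall>\<^sub>F k in sequentially. real k \<le> real k * ln (real k) - A * real k"
      by real_asymp
    with lower show ?thesis
      by eventually_elim simp
  qed
  have y_top: "filterlim y at_top sequentially"
    using filterlim_real_sequentially k_le by (rule filterlim_at_top_mono)
  text \<open>Solved for \<open>k\<close>, the upper bound on \<open>y\<close> reads \<open>g (y k) \<le> k\<close> with \<open>g t \<sim> t / ln t\<close>.\<close>
  define g where "g t = (t - B - ln t) / (ln t + C)" for t :: real
  have g_top: "filterlim g at_top at_top"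
    unfolding g_def by real_asymp
  have g_equiv: "(\<lambda>t. g t * ln (g t)) \<sim>[at_top] (\<lambda>t. t)"
    unfolding g_def by real_asymp
  have g_le: "\<forall>\<^sub>F k in sequentially. g (y k) \<le> real k"
  proof -
    have "\<forall>\<^sub>F t in at_top. ln t + C > 0"
      by real_asymp
    then have "\<forall>\<^sub>F k in sequentially. ln (y k) + C > 0"
      using y_top by (rule eventually_compose_filterlim)
    with upper k_le eventually_gt_at_top[of 0] show ?thesis
    proof eventually_elim
      case (elim k)
      \<comment> \<open>This absorbs the stray \<open>ln k\<close>, after which \<open>k\<close>
        occurs only as the factor to be solved for.\<close>
      then have "ln (real k) \<le> ln (y k)"
        by simp
      with elim have "y k - B - ln (y k) \<le> real k * (ln (y k) + C)"
        by linarith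
      with elim show ?case
        by (simp add: g_def pos_divide_le_eq)
    qed
  qed
  \<comment> \<open>From 1 onwards \<open>t * ln t\<close> is a product of nonnegative increasing
    factors, so it preserves \<open>g_le\<close>.\<close>
  have "\<forall>\<^sub>F k in sequentially. g (y k) \<ge> 1"
    using filterlim_compose[OF g_top y_top] by (simp add: filterlim_at_top)
  with g_le have low: "\<forall>\<^sub>F k in sequentially. g (y k) * ln (g (y k)) \<le> real k * ln (real k)"
    by eventually_elim (auto intro!: mult_mono)
  have small: "(\<lambda>k. A * real k) \<in> o(y)"
  proof -
    have "(\<lambda>k. A * real k) \<in> o(\<lambda>k. real k * ln (real k) - A * real k)"
      by real_asymp
    also have "(\<lambda>k. real k * ln (real k) - A * real k) \<in> O(y)"
    proof (rule bigoI[of _ 1])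
      have "\<forall>\<^sub>F k in sequentially. 0 \<le> real k * ln (real k) - A * real k"
        by real_asymp
      with lower show "\<forall>\<^sub>F k in sequentially. norm (real k * ln (real k) - A * real k) \<le> 1 * norm (y k)"
        by eventually_elim simp
    qed
    finally show ?thesis .
  qed
  have "(\<lambda>k. real k * ln (real k)) \<sim>[sequentially] y"
  proof (rule asymp_equiv_sandwich_real)
    show "(\<lambda>k. g (y k) * ln (g (y k))) \<sim>[sequentially] y"
      using asymp_equiv_compose'[OF g_equiv y_top] .
    show "(\<lambda>k. y k + A * real k) \<sim>[sequentially] y"
      using asymp_equiv_add_right[OF small] by simp
    show "\<forall>\<^sub>F k in sequentially. real k * ln (real k) \<in> {g (y k) * ln (g (y k))..y k + A * real k}"
      using low lower by eventually_elim auto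
  qed
  then show ?thesis
    by (rule asymp_equiv_symI)
qed

text \<open>Eventually \<open>f\<close> lies between \<open>g / 2\<close> and \<open>2 * g\<close>.
  A constant factor shifts the logarithm by a constant, which is negligible because
  \<open>ln g\<close> tends to infinity.\<close>

lemma asymp_equiv_ln:
  fixes f g :: "'a \<Rightarrow> real"
  assumes equiv: "f \<sim>[F] g" and top: "filterlim g at_top F"
  shows "(\<lambda>x. ln (f x)) \<sim>[F] (\<lambda>x. ln (g x))"
proof -
  have pos: "\<forall>\<^sub>F x in F. g x > 0"
    using top by (simp add: filterlim_at_top_dense)
  then have "((\<lambda>x. f x / g x) \<longlongrightarrow> 1) F"
    using equiv by (intro asymp_equivD_strong) (auto elim: eventually_mono)
  from order_tendstoD[OF this, of "1 / 2"] order_tendstoD[OF this, of 2]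
  have bounds: "\<forall>\<^sub>F x in F. 1 / 2 < f x / g x" "\<forall>\<^sub>F x in F. f x / g x < 2"
    by simp_all
  have const: "(\<lambda>x. ln (c * g x)) \<sim>[F] (\<lambda>x. ln (g x))" if "c > 0" for c
  proof (rule asymp_equiv_compose'[OF _ top])
    show "(\<lambda>t. ln (c * t)) \<sim>[at_top] ln"
      using that by real_asymp
  qed
  show ?thesis
  proof (rule asymp_equiv_sandwich_real[OF const[of "1 / 2"] const[of 2]])
    show "\<forall>\<^sub>F x in F. ln (f x) \<in> {ln (1 / 2 * g x)..ln (2 * g x)}"
      using pos bounds
    proof eventually_elim
      case (elim x)
      then have "1 / 2 * g x < f x" "f x < 2 * g x" "0 < 1 / 2 * g x"
        by (simp_all add: field_simps)
      then show ?case
        by (simp add: less_imp_le)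
    qed
  qed simp_all
qed

text \<open>The counting function \<open>N\<close> inverts \<open>a\<close> up to one index:
  \<open>a (N x) \<le> x < a (N x + 1)\<close>. Hence \<open>ln x \<sim> N x * ln (N x)\<close>,
  therefore \<open>ln (ln x) \<sim> ln (N x)\<close>, and the quotient is equivalent to
  \<open>N x\<close>.\<close>

lemma counting_asymp_equiv:
  fixes a :: "nat \<Rightarrow> nat"
  assumes mono: "\<And>j k. 1 \<le> j \<Longrightarrow> j < k \<Longrightarrow> a j < a k"
    and pos: "\<And>k. 1 \<le> k \<Longrightarrow> 1 \<le> a k"
    and equiv: "(\<lambda>k. ln (real (a k))) \<sim>[sequentially] (\<lambda>k. real k * ln (real k))"
  shows "(\<lambda>x. real (counting {a k |k. k \<ge> 1} x)) \<sim>[at_top] (\<lambda>x. ln x / ln (ln x))"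
proof -
  define N where "N x = counting {a k |k. k \<ge> 1} x" for x
  have a_ge: "k \<le> a k" if "1 \<le> k" for k
    using that
  proof (induction k rule: nat_induct_at_least)
    case base
    show ?case using pos[of 1] by simp
  next
    case (Suc k)
    then show ?case using mono[of k "Suc k"] by simp
  qed
  have inj: "inj_on a {1..}"
  proof (rule inj_onI)
    fix j k assume "j \<in> {1..}" "k \<in> {1..}" "a j = a k"
    then show "j = k"
      using mono[of j k] mono[of k j] by (cases j k rule: linorder_cases) auto
  qed
  have N_eq: "N x = card {k. 1 \<le> k \<and> real (a k) \<le> x}" for x
  proof -
    have "{b \<in> {a k |k. k \<ge> 1}. 1 \<le> real b \<and> real b \<le> x} = a ` {k. 1 \<le> k \<and> real (a k) \<le> x}"
      using pos by force
    moreover have "inj_on a {k. 1 \<le> k \<and> real (a k) \<le> x}"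
      by (rule inj_on_subset[OF inj]) auto
    ultimately show ?thesis
      unfolding N_def counting_def by (simp only: card_image)
  qed
  have fin: "finite {k. 1 \<le> k \<and> real (a k) \<le> x}" for x
  proof (rule finite_subset)
    show "{k. 1 \<le> k \<and> real (a k) \<le> x} \<subseteq> {..nat \<lfloor>x\<rfloor>}"
      using a_ge by (auto simp: le_nat_floor intro: order_trans le_nat_floor)
  qed simp
  \<comment> \<open>As \<open>a\<close> increases, the counted indices form an initial segment of
    the positive integers, so \<open>N\<close> and \<open>a\<close> are adjoint.\<close>
  have le_iff: "k \<le> N x \<longleftrightarrow> real (a k) \<le> x" if k: "1 \<le> k" for k x
  proof
    assume "real (a k) \<le> x"
    then have "real (a j) \<le> x" if "1 \<le> j" "j \<le> k" for j
      using mono[of j k] that by (cases "j = k") auto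
    then have "{1..k} \<subseteq> {k. 1 \<le> k \<and> real (a k) \<le> x}"
      by auto
    then have "card {1..k} \<le> N x"
      unfolding N_eq by (intro card_mono fin)
    then show "k \<le> N x" by simp
  next
    show "real (a k) \<le> x" if "k \<le> N x"
    proof (rule ccontr)
      assume *: "\<not> real (a k) \<le> x"
      have "{j. 1 \<le> j \<and> real (a j) \<le> x} \<subseteq> {1..<k}"
      proof safe
        fix j assume j: "1 \<le> j" "real (a j) \<le> x"
        show "j \<in> {1..<k}"
          using mono[of k j] k j * by (cases j k rule: linorder_cases) auto
      qed
      then have "N x \<le> card {1..<k}"
        unfolding N_eq by (intro card_mono) auto
      then show False
        using that k by simp
    qed
  qed
  have N_top: "filterlim N at_top at_top"
    unfolding filterlim_at_top
  proof
    fix Z :: nat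
    show "\<forall>\<^sub>F x in at_top. Z \<le> N x"
      \<comment> \<open>\<open>Suc Z\<close> instead of \<open>Z\<close>, since
        \<open>le_iff\<close> needs an index of at least 1.\<close>
      using eventually_ge_at_top[of "real (a (Suc Z))"]
      by eventually_elim (use le_iff[of "Suc Z"] in force)
  qed
  define F where "F t = t * ln t" for t :: real
  have N_real_top: "filterlim (\<lambda>x. real (N x)) at_top at_top"
    by (rule filterlim_compose[OF filterlim_real_sequentially N_top])
  have ln_equiv: "(\<lambda>x. ln x) \<sim>[at_top] (\<lambda>x. F (real (N x)))"
  proof (rule asymp_equiv_sandwich_real)
    show "(\<lambda>x. ln (real (a (N x)))) \<sim>[at_top] (\<lambda>x. F (real (N x)))"
      unfolding F_def using asymp_equiv_compose'[OF equiv N_top] .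
    have "filterlim (\<lambda>x. Suc (N x)) sequentially at_top"
      by (rule filterlim_compose[OF filterlim_Suc N_top])
    from asymp_equiv_compose'[OF equiv this]
    have "(\<lambda>x. ln (real (a (Suc (N x))))) \<sim>[at_top] (\<lambda>x. F (real (N x) + 1))"
      by (simp add: F_def add.commute)
    also have "(\<lambda>t. F (t + 1)) \<sim>[at_top] F"
      unfolding F_def by real_asymp
    from asymp_equiv_compose'[OF this N_real_top]
    have "(\<lambda>x. F (real (N x) + 1)) \<sim>[at_top] (\<lambda>x. F (real (N x)))" .
    finally show "(\<lambda>x. ln (real (a (Suc (N x))))) \<sim>[at_top] (\<lambda>x. F (real (N x)))" .
    \<comment> \<open>Nothing is assumed about \<open>a 0\<close>, so the lower end of the sandwich
      makes sense only once \<open>N x\<close> is positive.\<close>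
    have "\<forall>\<^sub>F x in at_top. 1 \<le> N x"
      using N_top by (simp add: filterlim_at_top)
    then show "\<forall>\<^sub>F x in at_top. ln x \<in> {ln (real (a (N x)))..ln (real (a (Suc (N x))))}"
      using eventually_gt_at_top[of 0]
    proof eventually_elim
      case (elim x)
      have "real (a (N x)) \<le> x" "x < real (a (Suc (N x)))"
        using le_iff[of "N x" x] le_iff[of "Suc (N x)" x] elim by auto
      moreover have "0 < a (N x)"
        using pos[of "N x"] elim by simp
      ultimately show ?case
        using elim by auto
    qed
  qed
  have lnln_equiv: "(\<lambda>x. ln (ln x)) \<sim>[at_top] (\<lambda>x. ln (real (N x)))"
  proof -
    have "filterlim F at_top at_top"
      unfolding F_def by real_asymp
    then have "(\<lambda>x. ln (ln x)) \<sim>[at_top] (\<lambda>x. ln (F (real (N x))))"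
      by (intro asymp_equiv_ln ln_equiv filterlim_compose[OF _ N_real_top])
    also have "(\<lambda>t. ln (F t)) \<sim>[at_top] ln"
      unfolding F_def by real_asymp
    from asymp_equiv_compose'[OF this N_real_top]
    have "(\<lambda>x. ln (F (real (N x)))) \<sim>[at_top] (\<lambda>x. ln (real (N x)))" .
    finally show ?thesis .
  qed
  have "(\<lambda>x. ln x / ln (ln x)) \<sim>[at_top] (\<lambda>x. F (real (N x)) / ln (real (N x)))"
    using ln_equiv lnln_equiv by (rule asymp_equiv_divide)
  also have "(\<lambda>t. F t / ln t) \<sim>[at_top] (\<lambda>t. t)"
    unfolding F_def by real_asymp
  from asymp_equiv_compose'[OF this N_real_top]
  have "(\<lambda>x. F (real (N x)) / ln (real (N x))) \<sim>[at_top] (\<lambda>x. real (N x))" .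
  finally show ?thesis
    unfolding N_def by (rule asymp_equiv_symI)
qed

section \<open>Chebyshev bounds for the nth prime\<close>

text \<open>The numbers \<open>Suc n * (n choose k)\<close> are the reciprocals of the entries of
  Leibniz's harmonic triangle. Each entry is a difference of two entries one column earlier, so
  integrality of \<open>d\<close> times an entry passes from column to column.\<close>

lemma Suc_times_binomial_dvd:
  fixes d :: nat
  assumes "k \<le> n" and "\<And>i. 1 \<le> i \<Longrightarrow> i \<le> Suc n \<Longrightarrow> i dvd d"
  shows "Suc n * (n choose k) dvd d"
  using assms
proof (induction k arbitrary: n)
  case 0
  then show ?case by simp
next
  case (Suc k)
  then obtain m where m: "n = Suc m" "k \<le> m"
    by (cases n) auto
  define A B C where "A = int (Suc n * (n choose k))" and "B = int (n * (m choose k))"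
    and "C = int (Suc n * (n choose Suc k))"
  have "A dvd int d" "B dvd int d"
    unfolding A_def B_def int_dvd_int_iff using Suc.IH[of n] Suc.IH[of m] Suc.prems m by simp_all
  then obtain a b where ab: "int d = A * a" "int d = B * b"
    unfolding dvd_def by blast
  have pos: "A > 0" "B > 0"
    using m by (simp_all only: A_def B_def of_nat_0_less_iff) (simp_all del: binomial_Suc_Suc mult_Suc)
  text \<open>Leibniz's harmonic triangle: \<open>1 / C = 1 / B - 1 / A\<close>.\<close>
  have 1: "Suc n * (n choose k) = (Suc n choose Suc k) * Suc k"
    by (rule Suc_times_binomial_eq)
  have 2: "n * (m choose k) = (n choose Suc k) * Suc k"
    unfolding m by (rule Suc_times_binomial_eq)
  have "Suc n * (n choose Suc k) * (Suc n * (n choose k)) =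
      Suc n * ((n choose Suc k) * Suc k) * (Suc n choose Suc k)"
    unfolding 1 by (simp only: ac_simps)
  also have "\<dots> = Suc n * (n * (m choose k)) * ((n choose k) + (n choose Suc k))"
    by (simp only: 2 binomial_Suc_Suc)
  also have "\<dots> = n * (m choose k) * (Suc n * (n choose k) + Suc n * (n choose Suc k))"
    by (simp only: algebra_simps)
  finally have id: "C * A = B * (A + C)"
    unfolding A_def B_def C_def by (simp only: flip: of_nat_mult of_nat_add)
  \<comment> \<open>The quotient of \<open>d\<close> by \<open>C\<close> is \<open>b - a\<close>, a
    difference, hence the cast to \<open>int\<close>. The factor \<open>A * B\<close> stands in for
    division and is cancelled through \<open>pos\<close>.\<close>
  have "C * (b - a) * (A * B) = C * A * (B * b) - B * C * (A * a)"
    by (simp add: algebra_simps)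
  also have "\<dots> = C * A * int d - B * C * int d"
    by (simp only: ab(1)[symmetric] ab(2)[symmetric])
  also have "\<dots> = B * (A + C) * int d - B * C * int d"
    by (simp only: id)
  also have "\<dots> = int d * (A * B)"
    by (simp only: algebra_simps)
  finally have "C * (b - a) = int d"
    using pos by simp
  then have "C dvd int d"
    by (metis dvd_triv_left)
  then show ?case
    unfolding C_def int_dvd_int_iff .
qed

text \<open>The least common multiple of 1, ..., \<open>Suc n\<close> is a product of one prime
  power per prime, each at most \<open>Suc n\<close>. By the previous lemma it is at least
  \<open>Suc n\<close> times the central binomial coefficient, which is at least the row sum
  \<open>2 ^ n\<close>.\<close>

lemma two_power_le_power_card_primes:
  "2 ^ n \<le> Suc n ^ card {p::nat. prime p \<and> p \<le> Suc n}"
proof -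
  define P where "P = {p::nat. prime p \<and> p \<le> Suc n}"
  \<comment> \<open>With the largest exponent of each prime, \<open>d\<close> becomes the least
    common multiple. The maximum is attained at some \<open>k\<close>, whence
    \<open>p ^ e p \<le> k\<close>.\<close>
  define e where "e p = Max ((\<lambda>k. multiplicity p k) ` {1..Suc n})" for p :: nat
  define d where "d = (\<Prod>p\<in>P. p ^ e p)"
  have fin: "finite P"
    unfolding P_def by (rule finite_subset[of _ "{..Suc n}"]) auto
  have dvd_d: "i dvd d" if i: "1 \<le> i" "i \<le> Suc n" for i
  proof -
    have "i = (\<Prod>p\<in>prime_factors i. p ^ multiplicity p i)"
      using i prime_factorization_nat[of i] by simp
    also have "\<dots> = (\<Prod>p\<in>P. p ^ multiplicity p i)"
    proof (rule prod.mono_neutral_left[OF fin])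
      show "prime_factors i \<subseteq> P"
      proof
        fix p assume "p \<in> prime_factors i"
        then show "p \<in> P"
          using i dvd_imp_le[of p i] by (auto simp: P_def prime_factors_dvd)
      qed
    next
      show "\<forall>p\<in>P - prime_factors i. p ^ multiplicity p i = 1"
        using i by (auto simp: P_def prime_factors_dvd not_dvd_imp_multiplicity_0)
    qed
    also have "\<dots> dvd d"
      unfolding d_def e_def using i by (intro prod_dvd_prod le_imp_power_dvd Max_ge) auto
    finally show ?thesis .
  qed
  have "p ^ e p \<le> Suc n" if "p \<in> P" for p
  proof -
    have "e p \<in> (\<lambda>k. multiplicity p k) ` {1..Suc n}"
      unfolding e_def by (rule Max_in) auto
    then obtain k where k: "k \<in> {1..Suc n}" "e p = multiplicity p k"
      by blast
    then have "p ^ e p dvd k"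
      by (simp add: multiplicity_dvd)
    then have "p ^ e p \<le> k"
      using k by (intro dvd_imp_le) auto
    then show ?thesis
      using k by simp
  qed
  then have d_le: "d \<le> Suc n ^ card P"
    unfolding d_def using prod_mono[of P "\<lambda>p. p ^ e p" "\<lambda>_. Suc n"] by simp
  have d_pos: "d > 0"
    unfolding d_def by (intro prod_pos) (auto simp: P_def prime_gt_0_nat)
  have "2 ^ n = (\<Sum>k\<le>n. n choose k)"
    by (simp add: choose_row_sum)
  also have "\<dots> \<le> (\<Sum>k\<le>n. n choose (n div 2))"
    by (intro sum_mono binomial_maximum)
  also have "\<dots> = Suc n * (n choose (n div 2))"
    by simp
  also have "\<dots> \<le> d"
    using Suc_times_binomial_dvd[of "n div 2" n d] dvd_d d_pos by (intro dvd_imp_le) auto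
  finally show ?thesis
    using d_le unfolding P_def by simp
qed

section \<open>Few primes: the primorial bound\<close>

lemma prod_primes_dvd:
  fixes n :: nat
  assumes "finite Q" "\<And>p. p \<in> Q \<Longrightarrow> prime p" "\<And>p. p \<in> Q \<Longrightarrow> p dvd n"
  shows "\<Prod>Q dvd n"
  using assms
proof (induction Q rule: finite_induct)
  case (insert p Q)
  have "coprime p (\<Prod>Q)"
    using insert by (intro prod_coprime_right primes_coprime) auto
  then show ?case
    using insert by (simp add: divides_mult)
qed simp

text \<open>Erdos's argument by strong induction: an even \<open>n > 2\<close> adds no prime, and
  for \<open>n = 2 * m + 1\<close> the primes above \<open>m + 1\<close> all divide
  \<open>n choose m\<close>, which is at most \<open>4 ^ m\<close>.\<close>

lemma prod_primes_le_power_4: "\<Prod>{p::nat. prime p \<and> p \<le> n} \<le> 4 ^ n"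
proof (induction n rule: less_induct)
  case (less n)
  define P where "P = (\<lambda>n::nat. {p::nat. prime p \<and> p \<le> n})"
  have IH: "\<Prod>(P m) \<le> 4 ^ m" if "m < n" for m
    using less that by (simp add: P_def)
  have fin: "finite (P m)" for m
    unfolding P_def by (rule finite_subset[of _ "{..m}"]) auto
  consider "n \<le> 1" | "n = 2" | "n > 2" "even n" | "n > 2" "odd n" by linarith
  then have "\<Prod>(P n) \<le> 4 ^ n"
  proof cases
    case 1
    then have "P n = {}"
      by (auto simp: P_def dest: prime_ge_2_nat)
    then show ?thesis by simp
  next
    case 2
    then have "P n = {2}"
      by (auto simp: P_def dest: prime_ge_2_nat)
    then show ?thesis using 2 by simp
  next
    case 3
    then have "\<not> prime n"
      using prime_odd_nat by auto
    then have "p \<le> n - 1" if "prime p" "p \<le> n" for p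
      using that by (cases "p = n") auto
    then have "P n = P (n - 1)"
      unfolding P_def by auto
    also have "\<Prod>(P (n - 1)) \<le> 4 ^ (n - 1)"
      using 3 by (intro IH) simp
    also have "\<dots> \<le> 4 ^ n"
      by (rule power_increasing) auto
    finally show ?thesis .
  next
    case 4
    then obtain m where m: "n = 2 * m + 1" "m > 0"
      by (auto elim!: oddE)
    define Q where "Q = P n - P (m + 1)"
    have Q: "prime p" "m + 1 < p" "p \<le> 2 * m + 1" if "p \<in> Q" for p
      using that m by (auto simp: Q_def P_def)
    have split: "P n = P (m + 1) \<union> Q"
      using m by (auto simp: Q_def P_def)
    have "\<Prod>Q dvd (2 * m + 1) choose m"
    proof (rule prod_primes_dvd)
      show "finite Q"
        unfolding Q_def using fin by simp
      fix p assume "p \<in> Q"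
      note p = Q[OF this]
      show "prime p" by fact
      have "fact m * fact (m + 1) * ((2 * m + 1) choose m) = (fact (2 * m + 1) :: nat)"
        using binomial_fact_lemma[of m "2 * m + 1"] by simp
      then have "p dvd fact m * fact (m + 1) * ((2 * m + 1) choose m)"
        using p prime_dvd_fact_iff[of p "2 * m + 1"] by simp
      \<comment> \<open>As \<open>p\<close> exceeds \<open>m + 1\<close>, it divides neither of the
        two factorials.\<close>
      then show "p dvd (2 * m + 1) choose m"
        using p by (simp only: prime_dvd_mult_iff prime_dvd_fact_iff) auto
    qed
    then have "\<Prod>Q \<le> (2 * m + 1) choose m"
      by (rule dvd_imp_le) simp
    also have "\<dots> \<le> 4 ^ m"
    proof -
      \<comment> \<open>The two middle entries of an odd row are equal, so each is at most half of
        the row sum.\<close>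
      have "(\<Sum>k\<in>{m, m + 1}. (2 * m + 1) choose k) \<le> (\<Sum>k\<le>2 * m + 1. (2 * m + 1) choose k)"
        by (rule sum_mono2) auto
      moreover have "(2 * m + 1) choose (m + 1) = (2 * m + 1) choose m"
        using binomial_symmetric[of m "2 * m + 1"] by simp
      ultimately have "2 * ((2 * m + 1) choose m) \<le> 2 ^ (2 * m + 1)"
        unfolding choose_row_sum by simp
      then show ?thesis
        by (simp add: power_mult)
    qed
    finally have "\<Prod>Q \<le> 4 ^ m" .
    moreover have "\<Prod>(P (m + 1)) \<le> 4 ^ (m + 1)"
      using m by (intro IH) simp
    moreover have "\<Prod>(P n) = \<Prod>(P (m + 1)) * \<Prod>Q"
      unfolding split using fin by (intro prod.union_disjoint) (auto simp: Q_def)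
    ultimately have "\<Prod>(P n) \<le> 4 ^ (m + 1) * 4 ^ m"
      by (simp add: mult_mono)
    also have "\<dots> = 4 ^ n"
      by (simp add: m(1) flip: power_add)
    finally show ?thesis .
  qed
  then show ?case by (simp add: P_def)
qed

text \<open>A weak Stirling bound: by \<open>n * ln (1 + 1 / n) \<le> 1\<close>, the left side grows
  by at most \<open>ln (n + 1)\<close> from \<open>n\<close> to \<open>n + 1\<close>.\<close>

lemma fact_ge_ln: "real n * (ln (real n) - 1) \<le> ln (fact n)"
proof (induction n)
  case (Suc n)
  show ?case
  proof (cases "n = 0")
    case False
    have "real n * (ln (real (Suc n)) - ln (real n)) \<le> 1"
    proof -
      have "ln (real (Suc n)) - ln (real n) = ln (1 + 1 / real n)"
        using False ln_div[of "real (Suc n)" "real n"] by (simp add: add_divide_distrib add.commute)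
      also have "\<dots> \<le> 1 / real n"
        by (rule ln_add_one_self_le_self) simp
      finally show ?thesis
        using False by (simp add: field_simps)
    qed
    moreover have "ln (fact (Suc n)) = ln (real (Suc n)) + ln (fact n)"
      by (simp add: ln_mult del: of_nat_Suc)
    ultimately show ?thesis
      using Suc.IH by (simp add: algebra_simps)
  qed simp
qed simp

section \<open>Transfer of both bounds to the nth prime\<close>

lemma nth_prime_gt: "1 \<le> n \<Longrightarrow> n < nth_prime n"
proof (induction n rule: nat_induct_at_least)
  case base
  show ?case using nth_prime_1 by simp
next
  case (Suc n)
  then show ?case using nth_prime_less[of n "Suc n"] by simp
qed

text \<open>This turns the product of the first \<open>n\<close> primes into a primorial and
  identifies \<open>n\<close> as the number of primes up to \<open>nth_prime n\<close>.\<close>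

lemma bij_betw_nth_prime:
  assumes "1 \<le> n"
  shows "bij_betw nth_prime {1..n} {p. prime p \<and> p \<le> nth_prime n}"
  unfolding bij_betw_def
proof
  show "inj_on nth_prime {1..n}"
  proof (rule inj_onI)
    fix j k assume "j \<in> {1..n}" "k \<in> {1..n}" "nth_prime j = nth_prime k"
    then show "j = k"
      using nth_prime_less[of j k] nth_prime_less[of k j]
      by (cases j k rule: linorder_cases) auto
  qed
  show "nth_prime ` {1..n} = {p. prime p \<and> p \<le> nth_prime n}"
  proof (intro equalityI subsetI)
    fix p assume p: "p \<in> {p. prime p \<and> p \<le> nth_prime n}"
    then obtain k where k: "k > 0" "nth_prime k = p"
      using nth_prime_surj by blast
    then have "k \<le> n"
      using nth_prime_less[of n k] p assms by (cases "k \<le> n") auto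
    then show "p \<in> nth_prime ` {1..n}"
      using k by force
  next
    fix p assume "p \<in> nth_prime ` {1..n}"
    then obtain k where k: "1 \<le> k" "k \<le> n" "p = nth_prime k"
      by auto
    then show "p \<in> {p. prime p \<and> p \<le> nth_prime n}"
      using nth_prime_less[of k n] nth_prime_prime by (cases "k = n") auto
  qed
qed

lemma nth_prime_lower_bound:
  assumes "1 \<le> n"
  shows "real n * (ln (real n) - 1) \<le> real (nth_prime n) * ln 4"
proof -
  have "fact n = (\<Prod>i\<in>{1..n}. i)"
    by (simp add: fact_prod)
  also have "\<dots> \<le> (\<Prod>i\<in>{1..n}. nth_prime i)"
    by (intro prod_mono) (auto intro: less_imp_le[OF nth_prime_gt])
  also have "\<dots> = \<Prod>{p. prime p \<and> p \<le> nth_prime n}"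
    by (rule prod.reindex_bij_betw[OF bij_betw_nth_prime[OF assms]])
  also have "\<dots> \<le> 4 ^ nth_prime n"
    by (rule prod_primes_le_power_4)
  finally have "real (fact n) \<le> real (4 ^ nth_prime n)"
    by (rule of_nat_mono)
  then have "ln (fact n) \<le> ln (4 ^ nth_prime n :: real)"
    by (subst ln_le_cancel_iff) auto
  then show ?thesis
    using fact_ge_ln[of n] by (simp add: ln_realpow)
qed

text \<open>The logarithm on the right is that of the prime, not of \<open>n\<close>: this is what
  the power bound yields directly, and the iteration can use it without inverting.\<close>

lemma nth_prime_upper_bound:
  assumes "1 \<le> n"
  shows "real (nth_prime n) * ln 2 \<le> 2 * real n * ln (real (nth_prime n))"
proof -
  define p where "p = nth_prime n"
  have p: "p \<ge> 2"
    unfolding p_def by (intro prime_ge_2_nat nth_prime_prime)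
  have "card {q. prime q \<and> q \<le> p} = n"
    unfolding p_def using bij_betw_same_card[OF bij_betw_nth_prime[OF assms]] by simp
  then have "2 ^ (p - 1) \<le> p ^ n"
    using two_power_le_power_card_primes[of "p - 1"] p by simp
  then have "real (2 ^ (p - 1)) \<le> real (p ^ n)"
    by (rule of_nat_mono)
  then have "ln (2 ^ (p - 1) :: real) \<le> ln (real p ^ n)"
    using p by (subst ln_le_cancel_iff) auto
  then have "(real p - 1) * ln 2 \<le> real n * ln (real p)"
    using p by (simp add: ln_realpow of_nat_diff)
  \<comment> \<open>The factor 2 pays for replacing \<open>p - 1\<close> by \<open>p\<close>, as
    \<open>p \<ge> 2\<close>.\<close>
  moreover have "real p * ln 2 \<le> 2 * ((real p - 1) * ln 2)"
    using p by simp
  ultimately show ?thesis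
    unfolding p_def by linarith
qed

section \<open>Growth of iterated primes\<close>

text \<open>Keeps the iterates away from the junk value of \<open>nth_prime\<close> at 0 and
  provides a first crude growth in \<open>k\<close>.\<close>

lemma iter_prime_ge: "1 \<le> n \<Longrightarrow> n + k \<le> iter_prime k n"
proof (induction k)
  case (Suc k)
  then show ?case
    using nth_prime_gt[of "iter_prime k n"] by simp
qed simp

lemma strict_mono_iter_prime:
  assumes "1 \<le> n"
  shows "strict_mono (\<lambda>k. iter_prime k n)"
  unfolding strict_mono_Suc_iff
proof
  fix k
  show "iter_prime k n < iter_prime (Suc k) n"
    using nth_prime_gt[of "iter_prime k n"] iter_prime_ge[OF assms, of k] assms by simp
qed

lemma iter_prime_less: "1 \<le> m \<Longrightarrow> m < n \<Longrightarrow> iter_prime k m < iter_prime k n"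
proof (induction k)
  case (Suc k)
  then show ?case
    using iter_prime_ge[of m k] by (simp add: nth_prime_less)
qed simp

text \<open>Each of the \<open>k\<close> increments of the logarithm is at most \<open>C\<close>
  plus an iterated logarithm, which monotonicity bounds by its value at the last iterate. The
  constant is independent of \<open>n\<close>, as the diagonal requires.\<close>

lemma ln_iter_prime_upper:
  fixes C :: real
  assumes "1 \<le> n" "1 \<le> k"
  defines "C \<equiv> ln 2 - ln (ln 2)"
  shows "ln (iter_prime k n) \<le> ln n + real k * (ln (ln (iter_prime k n)) + C)"
proof -
  define y where "y = (\<lambda>j. ln (real (iter_prime j n)))"
  have step: "y (Suc j) \<le> y j + (ln (y k) + C)" if "Suc j \<le> k" for j
  proof -
    define p q where "p = iter_prime j n" and "q = iter_prime (Suc j) n"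
    have p: "1 \<le> p"
      using iter_prime_ge[of n j] assms by (simp add: p_def)
    have q: "2 \<le> q"
      unfolding q_def using iter_prime_ge[of n "Suc j"] assms(1) by linarith
    have "q \<le> iter_prime k n"
      unfolding q_def using that strict_mono_less_eq[OF strict_mono_iter_prime] assms(1) by blast
    then have "ln (real q) \<le> y k"
      using q by (simp add: y_def)
    moreover have "0 < ln (real q)"
      using q by simp
    ultimately have lnln: "ln (ln (real q)) \<le> ln (y k)"
      by (subst ln_le_cancel_iff) auto
    \<comment> \<open>Taking logarithms here produces the two terms of \<open>C\<close>.\<close>
    have "real q * ln 2 \<le> 2 * real p * ln (real q)"
      using nth_prime_upper_bound[OF p] by (simp add: p_def q_def)
    then have "ln (real q * ln 2) \<le> ln (2 * real p * ln (real q))"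
      using p q by (subst ln_le_cancel_iff) auto
    also have "\<dots> = ln 2 + ln (real p) + ln (ln (real q))"
      using p q by (simp add: ln_mult)
    also have "ln (real q * ln 2) = ln (real q) + ln (ln 2)"
      using q by (simp add: ln_mult)
    finally show ?thesis
      using lnln by (simp add: C_def y_def p_def q_def)
  qed
  have "y j \<le> y 0 + real j * (ln (y k) + C)" if "j \<le> k" for j
    using that
  proof (induction j)
    case (Suc j)
    then show ?case
      using step[of j] by (simp add: algebra_simps)
  qed simp
  from this[of k] show ?thesis
    by (simp add: y_def)
qed

text \<open>A bootstrap: since \<open>y\<close> is unbounded, its increments eventually exceed 2; so
  \<open>y\<close> outgrows \<open>k + 1\<close>; so the increments are at least
  \<open>ln k - D\<close>, and these sum to a log-factorial.\<close>

lemma ln_iter_prime_lower: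
  assumes "1 \<le> n"
  shows "\<exists>C. \<forall>\<^sub>F k in sequentially. real k * ln (real k) - C * real k \<le> ln (iter_prime k n)"
proof -
  define y where "y = (\<lambda>k. ln (real (iter_prime k n)))"
  define D :: real where "D = ln (ln 4)"
  have y_top: "filterlim y at_top sequentially"
  proof (rule filterlim_at_top_mono)
    show "filterlim (\<lambda>k. ln (real k)) at_top sequentially"
      by real_asymp
    show "\<forall>\<^sub>F k in sequentially. ln (real k) \<le> y k"
      using eventually_gt_at_top[of 0]
    proof eventually_elim
      case (elim k)
      then show ?case
        using iter_prime_ge[OF assms, of k] by (simp add: y_def)
    qed
  qed
  have step: "y (Suc k) \<ge> y k + ln (y k - 1) - D" if "1 < y k" for k
  proof -
    define p q where "p = iter_prime k n" and "q = iter_prime (Suc k) n"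
    have p: "1 \<le> p"
      using iter_prime_ge[OF assms, of k] assms by (simp add: p_def)
    have q: "1 \<le> q"
      using iter_prime_ge[OF assms, of "Suc k"] by (simp add: q_def)
    have p': "0 < ln p - 1"
      using that by (simp add: p_def y_def)
    have "real p * (ln (real p) - 1) \<le> real q * ln 4"
      using nth_prime_lower_bound[OF p] by (simp add: p_def q_def)
    then have "ln (real p * (ln (real p) - 1)) \<le> ln (real q * ln 4)"
      using p q p' by (subst ln_le_cancel_iff) auto
    then show ?thesis
      using p q p' by (simp add: ln_mult p_def q_def y_def D_def)
  qed
  \<comment> \<open>The threshold is chosen so that \<open>ln (y k - 1) - D\<close> is at least
    2.\<close>
  obtain K where K: "\<And>k. k \<ge> K \<Longrightarrow> y k \<ge> 1 + exp (D + 2)"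
    using y_top unfolding filterlim_at_top eventually_at_top_linorder by blast
  have inc: "y (Suc k) \<ge> y k + 2" if "k \<ge> K" for k
  proof -
    have "exp (D + 2) \<le> y k - 1"
      using K[OF that] by simp
    moreover from this have "0 < y k - 1"
      by (rule less_le_trans[OF exp_gt_zero])
    ultimately have "D + 2 \<le> ln (y k - 1)"
      by (simp add: ln_ge_iff)
    then show ?thesis
      using step[of k] \<open>0 < y k - 1\<close> by simp
  qed
  have lin: "y k \<ge> 2 * (real k - real K)" if "k \<ge> K" for k
    using that
  proof (induction k rule: dec_induct)
    case base
    show ?case
      using K[of K] exp_gt_zero[of "D + 2"] by (simp del: exp_gt_zero)
  next
    case (step k)
    then show ?case
      using inc[of k] by simp
  qed
  \<comment> \<open>From here on \<open>2 * (k - K) - 1 \<ge> k\<close>, so \<open>lin\<close>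
    yields \<open>y k - 1 \<ge> k\<close>.\<close>
  define M where "M = 2 * K + 1"
  have step': "y (Suc k) \<ge> y k + ln (real k) - D" if "k \<ge> M" for k
  proof -
    have "real k \<le> y k - 1"
      using lin[of k] that by (simp add: M_def)
    moreover have "real k > 0"
      using that by (simp add: M_def)
    ultimately show ?thesis
      using step[of k] ln_le_cancel_iff[of "real k" "y k - 1"] by linarith
  qed
  text \<open>Summing the increments gives \<open>y k \<ge> ln (fact (k - 1)) - D * k - O(1)\<close>.\<close>
  define B where "B = ln (fact M) - y M"
  have "y k \<ge> ln (fact k) - (ln (real k) + D * (real k - real M)) - B + ln (real M)" if "k \<ge> M" for k
    using that
  proof (induction k rule: dec_induct)
    case base
    show ?case by (simp add: B_def)
  next
    case (step k)
    have "ln (fact (Suc k)) = ln (real (Suc k)) + ln (fact k)"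
      by (simp add: ln_mult del: of_nat_Suc)
    then show ?case
      using step step'[of k] by (simp add: algebra_simps)
  qed
  moreover have "ln (real k) \<le> real k" if "k \<ge> M" for k
    using that ln_le_minus_one[of "real k"] by (simp add: M_def)
  moreover have "0 \<le> ln (real M)"
    by (simp add: M_def)
  \<comment> \<open>Of the 2, one unit is the loss in \<open>fact_ge_ln\<close> and one comes from
    \<open>ln k \<le> k\<close>. A third unit below absorbs the constant.\<close>
  ultimately have *: "y k \<ge> real k * ln (real k) - (2 + D) * real k + (D * real M - B)" if "k \<ge> M" for k
    using fact_ge_ln[of k] that by (fastforce simp: algebra_simps)
  have "\<forall>\<^sub>F k in sequentially. \<bar>D * real M - B\<bar> \<le> real k"
    by real_asymp
  with eventually_ge_at_top[of M]
  have "\<forall>\<^sub>F k in sequentially. real k * ln (real k) - (3 + D) * real k \<le> y k"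
    by eventually_elim (use * in \<open>fastforce simp: algebra_simps\<close>)
  then show ?thesis
    unfolding y_def by blast
qed

text \<open>The start \<open>f k\<close> may vary with \<open>k\<close>, so that constant
  \<open>f\<close> gives the orbits and the identity gives the diagonal. Monotonicity in the start
  reduces the lower bound to start 1; the upper bound is uniform in the start and loses only
  \<open>ln N + ln k\<close>.\<close>

lemma ln_iter_prime_asymp_equiv:
  assumes "1 \<le> N" and f: "\<And>k. 1 \<le> k \<Longrightarrow> 1 \<le> f k \<and> f k \<le> N * k"
  shows "(\<lambda>k. ln (real (iter_prime k (f k)))) \<sim>[sequentially] (\<lambda>k. real k * ln (real k))"
proof -
  obtain A where A: "\<forall>\<^sub>F k in sequentially. real k * ln (real k) - A * real k \<le> ln (iter_prime k 1)"
    using ln_iter_prime_lower[of 1] by auto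
  show ?thesis
  proof (rule asymp_equiv_n_ln_n)
    show "\<forall>\<^sub>F k in sequentially. real k * ln (real k) - A * real k \<le> ln (iter_prime k (f k))"
      using A eventually_ge_at_top[of 1]
    proof eventually_elim
      case (elim k)
      have "iter_prime k 1 \<le> iter_prime k (f k)"
        using iter_prime_less[of 1 "f k" k] f[OF elim(2)] by (cases "f k = 1") auto
      moreover have "0 < iter_prime k 1"
        using iter_prime_ge[of 1 k] by simp
      ultimately have "ln (real (iter_prime k 1)) \<le> ln (real (iter_prime k (f k)))"
        by simp
      with elim(1) show ?case
        by (rule order_trans)
    qed
    show "\<forall>\<^sub>F k in sequentially. ln (iter_prime k (f k)) \<le>
        ln N + ln k + real k * (ln (ln (iter_prime k (f k))) + (ln 2 - ln (ln 2)))"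
      using eventually_ge_at_top[of 1]
    proof eventually_elim
      case (elim k)
      have "real (f k) \<le> real (N * k)"
        using f[OF elim] by (intro of_nat_mono) simp
      then have "ln (real (f k)) \<le> ln (real N * real k)"
        using f[OF elim] by (subst ln_le_cancel_iff) auto
      also have "\<dots> = ln (real N) + ln (real k)"
        using elim assms(1) by (simp add: ln_mult)
      finally show ?case
        using ln_iter_prime_upper[of "f k" k] f[OF elim] elim by linarith
    qed
  qed
qed

theorem theorem3p3:
  shows "(\<forall>n\<ge>1. (\<lambda>x::real. real (counting (prime_orbit n) x)) \<sim>[at_top] (\<lambda>x. ln x / ln (ln x))) \<and>
         (\<lambda>x::real. real (counting diag_primes x)) \<sim>[at_top] (\<lambda>x. ln x / ln (ln x))"
proof (intro conjI allI impI)
  fix n :: nat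
  assume n: "1 \<le> n"
  show "(\<lambda>x::real. real (counting (prime_orbit n) x)) \<sim>[at_top] (\<lambda>x. ln x / ln (ln x))"
    unfolding prime_orbit_def
  proof (rule counting_asymp_equiv)
    show "iter_prime j n < iter_prime k n" if "j < k" for j k
      using strict_monoD[OF strict_mono_iter_prime[OF n] that] .
    show "1 \<le> iter_prime k n" for k
      using iter_prime_ge[OF n, of k] n by linarith
    show "(\<lambda>k. ln (real (iter_prime k n))) \<sim>[sequentially] (\<lambda>k. real k * ln (real k))"
      using n by (intro ln_iter_prime_asymp_equiv[of n "\<lambda>_. n"]) auto
  qed
next
  show "(\<lambda>x::real. real (counting diag_primes x)) \<sim>[at_top] (\<lambda>x. ln x / ln (ln x))"
    unfolding diag_primes_def
  proof (rule counting_asymp_equiv)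
    \<comment> \<open>The comparison passes through \<open>iter_prime j k\<close>: first the start
      grows, then the number of iterations.\<close>
    show "iter_prime j j < iter_prime k k" if "1 \<le> j" "j < k" for j k
      using iter_prime_less[of j k j] strict_monoD[OF strict_mono_iter_prime[of k], of j k] that by simp
    show "1 \<le> iter_prime k k" if "1 \<le> k" for k
      using iter_prime_ge[OF that, of k] that by linarith
    show "(\<lambda>k. ln (real (iter_prime k k))) \<sim>[sequentially] (\<lambda>k. real k * ln (real k))"
      by (intro ln_iter_prime_asymp_equiv[of 1 "\<lambda>k. k"]) auto
  qed
qed

end
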